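(* Let $(u,v,g,h)$ be the unique global solution of the free boundary problem described in the context. If $g_\infty<\infty$, then $\lim_{t\to\infty}\max_{0\le x\le g(t)}u(t,x)=0$. If $h_\infty<\infty$, then $\lim_{t\to\infty}\max_{0\le x\le h(t)}v(t,x)=0$.
   Context: Let $a,b,c,d,\beta,\mu>0$ and $0<h_0\le g_0$. Let $u_0\in C^2([0,g_0])$ with $u_0'(0)=0$, $u_0>0$ in $[0,g_0)$, $u_0=0$ in $[g_0,\infty)$, and $v_0\in C^2([0,h_0])$ with $v_0'(0)=0$, $v_0>0$ in $[0,h_0)$, $v_0=0$ in $[h_0,\infty)$. The problem is: $u_t-du_{xx}=u(a-u-bv)$ for $t>0$, $0<x<g(t)$; $v_t-v_{xx}=v(1-v+cu)$ for $t>0$, $0<x<h(t)$; $u_x(t,0)=v_x(t,0)=0$; $g'(t)=-\beta u_x(t,g(t))$, $h'(t)=-\mu v_x(t,h(t))$; $u(t,x)=0$ for $x\ge g(t)$, $v(t,x)=0$ for $x\ge h(t)$; $u(0,\cdot)=u_0$, $v(0,\cdot)=v_0$, $g(0)=g_0$, $h(0)=h_0$. It has a unique global classical solution with $g,h$ increasing; $g_\infty=\lim_{t\to\infty}g(t)\in(0,\infty]$, $h_\infty=\lim_{t\to\infty}h(t)\in(0,\infty]$. *)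

theory Defs
  imports "HOL-Analysis.Analysis"
begin

definition initial_datum :: "(real \<Rightarrow> real) \<Rightarrow> real \<Rightarrow> bool" where
  "initial_datum w0 z0 \<longleftrightarrow>
     (\<exists>w1 w2. (\<forall>x\<in>{0..z0}. (w0 has_real_derivative w1 x) (at x within {0..z0})
                        \<and> (w1 has_real_derivative w2 x) (at x within {0..z0}))
             \<and> continuous_on {0..z0} w2 \<and> w1 0 = 0)
     \<and> (\<forall>x. 0 \<le> x \<and> x < z0 \<longrightarrow> w0 x > 0)
     \<and> (\<forall>x. z0 \<le> x \<longrightarrow> w0 x = 0)"

definition fb_component ::
  "real \<Rightarrow> real \<Rightarrow> (real \<Rightarrow> real \<Rightarrow> real) \<Rightarrow> (real \<Rightarrow> real \<Rightarrow> real) \<Rightarrow> (real \<Rightarrow> real)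
    \<Rightarrow> (real \<Rightarrow> real) \<Rightarrow> real \<Rightarrow> bool" where
  "fb_component D kappa F w z w0 z0 \<longleftrightarrow>
     z 0 = z0 \<and> continuous_on {0..} z
     \<and> (\<forall>x\<ge>0. w 0 x = w0 x)
     \<and> (\<forall>t\<ge>0. \<forall>x\<ge>z t. w t x = 0)
     \<and> continuous_on {p. 0 \<le> fst p \<and> 0 \<le> snd p \<and> snd p \<le> z (fst p)} (\<lambda>p. w (fst p) (snd p))
     \<and> (\<exists>wx wxx wt.
          continuous_on {p. 0 < fst p \<and> 0 \<le> snd p \<and> snd p \<le> z (fst p)} (\<lambda>p. wx (fst p) (snd p))
        \<and> continuous_on {p. 0 < fst p \<and> 0 < snd p \<and> snd p < z (fst p)} (\<lambda>p. wxx (fst p) (snd p))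
        \<and> continuous_on {p. 0 < fst p \<and> 0 < snd p \<and> snd p < z (fst p)} (\<lambda>p. wt (fst p) (snd p))
        \<and> (\<forall>t>0. \<forall>x\<in>{0..z t}. (w t has_real_derivative wx t x) (at x within {0..z t}))
        \<and> (\<forall>t>0. \<forall>x. 0 < x \<and> x < z t \<longrightarrow>
              (wx t has_real_derivative wxx t x) (at x)
            \<and> ((\<lambda>s. w s x) has_real_derivative wt t x) (at t)
            \<and> wt t x - D * wxx t x = F t x)
        \<and> (\<forall>t>0. wx t 0 = 0)
        \<and> (\<forall>t>0. (z has_real_derivative (- kappa * wx t (z t))) (at t)))"

definition fbp_solution ::
  "real \<Rightarrow> real \<Rightarrow> real \<Rightarrow> real \<Rightarrow> real \<Rightarrow> real \<Rightarrow> real \<Rightarrow> real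
    \<Rightarrow> (real \<Rightarrow> real) \<Rightarrow> (real \<Rightarrow> real)
    \<Rightarrow> (real \<Rightarrow> real \<Rightarrow> real) \<Rightarrow> (real \<Rightarrow> real \<Rightarrow> real) \<Rightarrow> (real \<Rightarrow> real) \<Rightarrow> (real \<Rightarrow> real) \<Rightarrow> bool" where
  "fbp_solution a b c d \<beta> \<mu> g0 h0 u0 v0 u v g h \<longleftrightarrow>
     fb_component d \<beta> (\<lambda>t x. u t x * (a - u t x - b * v t x)) u g u0 g0
   \<and> fb_component 1 \<mu> (\<lambda>t x. v t x * (1 - v t x + c * u t x)) v h v0 h0"

end

theory Submission
  imports Defs
begin

text \<open>
  Write \<open>w\<close> for either component, \<open>z\<close> for its free boundary and \<open>Z\<close> for the limit of \<open>z\<close>. Let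
  \<open>N t = \<integral>\<^sub>0\<^sup>Z exp (k x) w t x dx\<close>. If \<open>k\<close> is so large that \<open>D k\<^sup>2\<close> beats the reaction rate, integration by
  parts gives \<open>N' \<ge> N - C z'\<close>, because the flux through the boundary is \<open>z' / \<kappa>\<close>. Hence
  \<open>Y = N - C (Z - z)\<close> satisfies \<open>Y' \<ge> N \<ge> Y\<close>. As \<open>Y\<close> is bounded it is never positive, that is
  \<open>N \<le> C (Z - z) \<rightarrow> 0\<close>. No parabolic regularity is needed to pass from \<open>N\<close> to the supremum: a maximum
  principle for \<open>w t x - w t y - \<psi> (y - x)\<close> with \<open>x \<le> y\<close> and a concave \<open>\<psi>\<close> bounds the decrease of
  \<open>w t\<close> uniformly in time, so that a large value of \<open>w t\<close> forces a large \<open>N t\<close>.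
\<close>

lemma DERIV_nonneg_of_left_le:
  fixes f :: "real \<Rightarrow> real"
  assumes "(f has_real_derivative l) (at t)" and "e > 0"
    and "\<And>s. t - e < s \<Longrightarrow> s < t \<Longrightarrow> f s \<le> f t"
  shows "l \<ge> 0"
proof (rule ccontr)
  assume "\<not> l \<ge> 0"
  then obtain d where d: "d > 0" "\<And>h. 0 < h \<Longrightarrow> h < d \<Longrightarrow> f t < f (t - h)"
    using DERIV_neg_dec_left[OF assms(1)] by auto
  define h where "h = min d e / 2"
  have "0 < h" "h < d" "h < e" using d(1) \<open>e > 0\<close> by (auto simp: h_def)
  with d(2)[of h] assms(3)[of "t - h"] show False by auto
qed

lemma second_derivative_nonpos_at_local_max:
  fixes f f' :: "real \<Rightarrow> real"
  assumes "e > 0"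
    and f: "\<And>y. \<bar>y - x\<bar> < e \<Longrightarrow> (f has_real_derivative f' y) (at y)"
    and f': "(f' has_real_derivative l) (at x)"
    and mx: "\<And>y. \<bar>y - x\<bar> < e \<Longrightarrow> f y \<le> f x"
  shows "l \<le> 0"
proof (rule ccontr)
  assume "\<not> l \<le> 0"
  have "f' x = 0"
    by (rule DERIV_local_max[OF f \<open>e > 0\<close>]) (use mx \<open>e > 0\<close> in \<open>auto simp: abs_minus_commute\<close>)
  with \<open>\<not> l \<le> 0\<close> obtain d where d: "d > 0" "\<And>h. 0 < h \<Longrightarrow> h < d \<Longrightarrow> 0 < f' (x + h)"
    using DERIV_pos_inc_right[OF f'] by auto
  define h where "h = min d e / 2"
  have h: "0 < h" "h < d" "h < e" using d(1) \<open>e > 0\<close> by (auto simp: h_def)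
  have "f x < f (x + h)"
  proof (rule DERIV_pos_imp_increasing_open[where f = f])
    show "x < x + h" using h by simp
    fix y assume "x < y" "y < x + h"
    then show "\<exists>l. DERIV f y :> l \<and> 0 < l"
      using f[of y] d(2)[of "y - x"] h by (intro exI[of _ "f' y"]) auto
  next
    show "continuous_on {x..x + h} f"
      by (rule DERIV_continuous_on[of _ _ f'], rule has_field_derivative_at_within, rule f) (use h in auto)
  qed
  with mx[of "x + h"] h show False by auto
qed

lemma right_derivative_nonpos_at_max:
  fixes f :: "real \<Rightarrow> real"
  assumes f: "(f has_real_derivative l) (at x within {x..b})" and "x < b" "e > 0"
    and mx: "\<And>y. x < y \<Longrightarrow> y < x + e \<Longrightarrow> y \<le> b \<Longrightarrow> f y \<le> f x"
  shows "l \<le> 0"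
proof (rule ccontr)
  assume "\<not> l \<le> 0"
  then obtain d where d: "d > 0" "\<And>h. 0 < h \<Longrightarrow> x + h \<in> {x..b} \<Longrightarrow> h < d \<Longrightarrow> f x < f (x + h)"
    using has_real_derivative_pos_inc_right[OF f] by auto
  define h where "h = min (min d e) (b - x) / 2"
  have "0 < h" "h < d" "h < e" "x + h \<in> {x..b}" using d(1) assms by (auto simp: h_def field_simps)
  with d(2)[of h] mx[of "x + h"] show False by auto
qed

lemma right_Dini_nonneg_imp_le:
  fixes f :: "real \<Rightarrow> real"
  assumes "a \<le> b" and cont: "continuous_on {a..b} f"
    and dini: "\<And>t \<eta>. a \<le> t \<Longrightarrow> t < b \<Longrightarrow> \<eta> > 0 \<Longrightarrow>
      \<exists>e>0. \<forall>s. t < s \<and> s < t + e \<longrightarrow> f s - f t \<ge> - \<eta> * (s - t)"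
  shows "f a \<le> f b"
proof -
  have *: "f b - f a \<ge> - \<eta> * (b - a)" if "\<eta> > 0" for \<eta>
  proof -
    define S where "S = {t\<in>{a..b}. - \<eta> * (t - a) \<le> f t - f a}"
    have "closed S" unfolding S_def
      by (intro continuous_on_closed_Collect_le continuous_intros cont)
    moreover have "a \<in> S" using \<open>a \<le> b\<close> by (auto simp: S_def)
    moreover have bdd: "bdd_above S" by (rule bdd_aboveI[of _ b]) (auto simp: S_def)
    ultimately have c: "Sup S \<in> S" using closed_contains_Sup by blast
    define c where "c = Sup S"
    have cS: "a \<le> c" "c \<le> b" "- \<eta> * (c - a) \<le> f c - f a" using c by (auto simp: S_def c_def)
    have "c = b"
    proof (rule ccontr)
      assume "c \<noteq> b"
      with cS have "c < b" by auto
      obtain e where e: "e > 0" "\<And>s. c < s \<Longrightarrow> s < c + e \<Longrightarrow> f s - f c \<ge> - \<eta> * (s - c)"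
        using dini[OF \<open>a \<le> c\<close> \<open>c < b\<close> \<open>\<eta> > 0\<close>] by blast
      define s where "s = c + min e (b - c) / 2"
      have s: "c < s" "s < c + e" "s \<le> b" using e(1) \<open>c < b\<close> by (auto simp: s_def field_simps)
      have "s \<in> S" using e(2)[OF s(1,2)] cS s by (auto simp: S_def algebra_simps)
      then have "s \<le> c" unfolding c_def using bdd by (rule cSup_upper)
      with s show False by simp
    qed
    with cS show ?thesis by simp
  qed
  show ?thesis
  proof (rule field_le_epsilon)
    fix \<epsilon> :: real assume "\<epsilon> > 0"
    define \<eta> where "\<eta> = \<epsilon> / (b - a + 1)"
    have "\<eta> > 0" using \<open>\<epsilon> > 0\<close> \<open>a \<le> b\<close> by (simp add: \<eta>_def)
    have "\<eta> * (b - a) \<le> \<epsilon>" using \<open>\<epsilon> > 0\<close> \<open>a \<le> b\<close> by (simp add: \<eta>_def field_simps)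
    with *[OF \<open>\<eta> > 0\<close>] show "f a \<le> f b + \<epsilon>" by simp
  qed
qed

lemma initial_datum_lipschitz:
  assumes "initial_datum w0 z0"
  shows "\<exists>L>0. \<forall>x y. 0 \<le> x \<longrightarrow> x \<le> y \<longrightarrow> w0 x - w0 y \<le> L * (y - x)"
proof -
  obtain w1 w2 where w: "\<And>x. x \<in> {0..z0} \<Longrightarrow> (w0 has_real_derivative w1 x) (at x within {0..z0})"
      "\<And>x. x \<in> {0..z0} \<Longrightarrow> (w1 has_real_derivative w2 x) (at x within {0..z0})"
    using assms unfolding initial_datum_def by blast
  have w0: "\<And>x. z0 \<le> x \<Longrightarrow> w0 x = 0" using assms unfolding initial_datum_def by blast
  have "continuous_on {0..z0} w1" using w(2) by (rule DERIV_continuous_on)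
  then have "bounded (w1 ` {0..z0})" by (intro compact_imp_bounded compact_continuous_image) auto
  then obtain L where L: "\<And>x. x \<in> {0..z0} \<Longrightarrow> \<bar>w1 x\<bar> \<le> L" unfolding bounded_real by blast
  have "w0 x - w0 y \<le> max L 1 * (y - x)" if "0 \<le> x" "x \<le> y" for x y
  proof (cases "x < z0")
    case True
    define y' where "y' = min y z0"
    have y': "x \<le> y'" "y' \<le> y" "y' \<le> z0" "w0 y = w0 y'" using that True w0 by (auto simp: y'_def min_def)
    have "norm (w0 x - w0 y') \<le> max L 1 * norm (x - y')"
      using that y' True L by (intro field_differentiable_bound[of "{0..z0}" w0 w1] w) (auto simp: le_max_iff_disj)
    then have "w0 x - w0 y' \<le> max L 1 * (y' - x)" using y' by simp
    also have "\<dots> \<le> max L 1 * (y - x)" using y' by (intro mult_left_mono) auto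
    finally show ?thesis using y' by simp
  qed (use that w0 in auto)
  then show ?thesis by (intro exI[of _ "max L 1"]) auto
qed

locale free_boundary =
  fixes D \<kappa> z0 :: real and F w wx wxx wt :: "real \<Rightarrow> real \<Rightarrow> real" and z w0 :: "real \<Rightarrow> real"
  assumes D_pos: "D > 0" and \<kappa>_pos: "\<kappa> > 0" and z0_pos: "z0 > 0"
    and init: "initial_datum w0 z0"
    and z_init: "z 0 = z0" and z_cont: "continuous_on {0..} z"
    and w_init: "\<And>x. 0 \<le> x \<Longrightarrow> w 0 x = w0 x"
    and w_outside: "\<And>t x. 0 \<le> t \<Longrightarrow> z t \<le> x \<Longrightarrow> w t x = 0"
    and w_cont: "continuous_on {p. 0 \<le> fst p \<and> 0 \<le> snd p \<and> snd p \<le> z (fst p)} (\<lambda>p. w (fst p) (snd p))"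
    and wx_cont: "continuous_on {p. 0 < fst p \<and> 0 \<le> snd p \<and> snd p \<le> z (fst p)} (\<lambda>p. wx (fst p) (snd p))"
    and wt_cont: "continuous_on {p. 0 < fst p \<and> 0 < snd p \<and> snd p < z (fst p)} (\<lambda>p. wt (fst p) (snd p))"
    and w_x: "\<And>t x. 0 < t \<Longrightarrow> 0 \<le> x \<Longrightarrow> x \<le> z t \<Longrightarrow> (w t has_real_derivative wx t x) (at x within {0..z t})"
    and w_xx: "\<And>t x. 0 < t \<Longrightarrow> 0 < x \<Longrightarrow> x < z t \<Longrightarrow> (wx t has_real_derivative wxx t x) (at x)"
    and w_t: "\<And>t x. 0 < t \<Longrightarrow> 0 < x \<Longrightarrow> x < z t \<Longrightarrow> ((\<lambda>s. w s x) has_real_derivative wt t x) (at t)"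
    and pde: "\<And>t x. 0 < t \<Longrightarrow> 0 < x \<Longrightarrow> x < z t \<Longrightarrow> wt t x = D * wxx t x + F t x"
    and neumann: "\<And>t. 0 < t \<Longrightarrow> wx t 0 = 0"
    and stefan: "\<And>t. 0 < t \<Longrightarrow> (z has_real_derivative (- \<kappa> * wx t (z t))) (at t)"

lemma fb_component_imp_free_boundary:
  assumes "fb_component D \<kappa> F w z w0 z0" "D > 0" "\<kappa> > 0" "z0 > 0" "initial_datum w0 z0"
  shows "\<exists>wx wxx wt. free_boundary D \<kappa> z0 F w wx wxx wt z w0"
proof -
  from assms(1)[unfolded fb_component_def] obtain wx wxx wt where w:
     "continuous_on {p. 0 < fst p \<and> 0 \<le> snd p \<and> snd p \<le> z (fst p)} (\<lambda>p. wx (fst p) (snd p))"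
     "continuous_on {p. 0 < fst p \<and> 0 < snd p \<and> snd p < z (fst p)} (\<lambda>p. wt (fst p) (snd p))"
     "\<forall>t>0. \<forall>x\<in>{0..z t}. (w t has_real_derivative wx t x) (at x within {0..z t})"
     "\<forall>t>0. \<forall>x. 0 < x \<and> x < z t \<longrightarrow>
              (wx t has_real_derivative wxx t x) (at x)
            \<and> ((\<lambda>s. w s x) has_real_derivative wt t x) (at t)
            \<and> wt t x - D * wxx t x = F t x"
     "\<forall>t>0. wx t 0 = 0"
     "\<forall>t>0. (z has_real_derivative (- \<kappa> * wx t (z t))) (at t)"
    by (elim conjE exE) (rule that)
  have interior: "(wx t has_real_derivative wxx t x) (at x)"
      "((\<lambda>s. w s x) has_real_derivative wt t x) (at t)"
      "wt t x = D * wxx t x + F t x" if "0 < t" "0 < x" "x < z t" for t x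
    using w(4)[rule_format, of t x] that by simp_all
  have w_x: "(w t has_real_derivative wx t x) (at x within {0..z t})"
    if "0 < t" "0 \<le> x" "x \<le> z t" for t x
    using w(3)[rule_format, of t x] that by simp
  have z: "z 0 = z0" "continuous_on {0..} z" "\<And>x. 0 \<le> x \<Longrightarrow> w 0 x = w0 x"
    "\<And>t x. 0 \<le> t \<Longrightarrow> z t \<le> x \<Longrightarrow> w t x = 0"
    "continuous_on {p. 0 \<le> fst p \<and> 0 \<le> snd p \<and> snd p \<le> z (fst p)} (\<lambda>p. w (fst p) (snd p))"
    using assms(1) unfolding fb_component_def by blast+
  have "free_boundary D \<kappa> z0 F w wx wxx wt z w0"
    by (rule free_boundary.intro[OF assms(2-5) z w(1,2) w_x interior w(5,6)[rule_format]])
  then show ?thesis by blast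
qed

context free_boundary
begin

lemma w_x_interior:
  assumes "0 < t" "0 < x" "x < z t"
  shows "(w t has_real_derivative wx t x) (at x)"
proof -
  have "at x within {0..z t} = at x" using assms by (intro at_within_interior) auto
  with w_x[of t x] assms show ?thesis by auto
qed

lemma w_continuous: "continuous_on {p. 0 \<le> fst p \<and> 0 \<le> snd p} (\<lambda>p. w (fst p) (snd p))"
proof -
  let ?S = "{p :: real \<times> real. 0 \<le> fst p \<and> 0 \<le> snd p}"
  have "continuous_on ?S (\<lambda>p. if snd p - z (fst p) \<le> 0 then w (fst p) (snd p) else 0)"
  proof (rule continuous_on_cases_le)
    show "continuous_on {t \<in> ?S. snd t - z (fst t) \<le> 0} (\<lambda>p. w (fst p) (snd p))"
      by (rule continuous_on_subset[OF w_cont]) auto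
    show "continuous_on ?S (\<lambda>p. snd p - z (fst p))"
      by (intro continuous_intros continuous_on_compose2[OF z_cont]) auto
  qed (auto simp: w_outside)
  then show ?thesis
    by (rule continuous_on_eq) (auto simp: w_outside)
qed

lemma w_continuous_x: "0 \<le> t \<Longrightarrow> 0 \<le> a \<Longrightarrow> continuous_on {a..b} (w t)"
  by (rule continuous_on_compose2[OF w_continuous, of _ "\<lambda>x. (t, x)", simplified])
     (auto intro!: continuous_intros)

lemma z_bounded_on: "\<exists>R>0. \<forall>t\<in>{0..T}. z t \<le> R"
proof -
  have "bounded (z ` {0..T})"
    by (intro compact_imp_bounded compact_continuous_image continuous_on_subset[OF z_cont]) auto
  then obtain R where "\<And>t. t \<in> {0..T} \<Longrightarrow> \<bar>z t\<bar> \<le> R" unfolding bounded_real by blast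
  then show ?thesis by (intro exI[of _ "max R 1"]) (auto simp: abs_le_iff le_max_iff_disj)
qed

lemma w_bounded_on: "\<exists>B\<ge>0. \<forall>t x. 0 \<le> t \<longrightarrow> t \<le> T \<longrightarrow> 0 \<le> x \<longrightarrow> \<bar>w t x\<bar> \<le> B"
proof -
  obtain R where R: "\<And>t. t \<in> {0..T} \<Longrightarrow> z t \<le> R" using z_bounded_on by blast
  have "bounded ((\<lambda>p. w (fst p) (snd p)) ` ({0..T} \<times> {0..R}))"
    by (intro compact_imp_bounded compact_continuous_image compact_Times compact_Icc
        continuous_on_subset[OF w_continuous]) auto
  then obtain B where B: "\<And>t x. t \<in> {0..T} \<Longrightarrow> x \<in> {0..R} \<Longrightarrow> \<bar>w t x\<bar> \<le> B"
    unfolding bounded_real by fastforce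
  have "\<bar>w t x\<bar> \<le> max B 0" if "0 \<le> t" "t \<le> T" "0 \<le> x" for t x
    using B[of t x] R[of t] w_outside[of t x] that by (cases "x \<le> R") (auto simp: le_max_iff_disj)
  then show ?thesis by (intro exI[of _ "max B 0"]) auto
qed

text \<open>
  The equation is not assumed to hold at \<open>x = 0\<close>. The term linear in \<open>x\<close> added to \<open>w\<close> in the next proofs
  keeps the extremum away from there, since the Neumann condition makes the derivative at \<open>0\<close> nonzero.
\<close>

lemma w_nonneg:
  assumes Q: "\<And>T. \<exists>Q. \<forall>t x. 0 < t \<longrightarrow> t \<le> T \<longrightarrow> 0 < x \<longrightarrow> x < z t \<longrightarrow> w t x < 0 \<longrightarrow> Q * w t x \<le> F t x"
    and "0 \<le> T" "0 \<le> X"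
  shows "0 \<le> w T X"
proof (rule ccontr)
  assume neg: "\<not> 0 \<le> w T X"
  obtain Q where Q: "\<And>t x. 0 < t \<Longrightarrow> t \<le> T \<Longrightarrow> 0 < x \<Longrightarrow> x < z t \<Longrightarrow> w t x < 0 \<Longrightarrow> Q * w t x \<le> F t x"
    using assms(1)[of T] by blast
  obtain R where R: "R > 0" "\<And>t. t \<in> {0..T} \<Longrightarrow> z t \<le> R" using z_bounded_on by blast
  define k where "k = Q + 1"
  define \<epsilon> where "\<epsilon> = - exp (- k * T) * w T X / (2 * R)"
  have eps: "\<epsilon> > 0" using neg R(1) by (simp add: \<epsilon>_def divide_neg_pos mult_pos_neg)
  have "X \<le> R" using R(2)[of T] neg w_outside[of T X] \<open>0 \<le> T\<close>
    by (smt (verit) atLeastAtMost_iff)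
  let ?f = "\<lambda>p. exp (- k * fst p) * w (fst p) (snd p) - \<epsilon> * snd p"
  have "continuous_on ({0..T} \<times> {0..R}) ?f"
    by (intro continuous_intros continuous_on_subset[OF w_continuous]) auto
  moreover have "compact ({0..T} \<times> {0..R})" by (intro compact_Times compact_Icc)
  moreover have "(T, X) \<in> {0..T} \<times> {0..R}" using assms \<open>X \<le> R\<close> by auto
  ultimately obtain p where p: "p \<in> {0..T} \<times> {0..R}" "\<And>y. y \<in> {0..T} \<times> {0..R} \<Longrightarrow> ?f p \<le> ?f y"
    using continuous_attains_inf[of "{0..T} \<times> {0..R}" ?f] by blast
  obtain t x where tx: "p = (t, x)" by (cases p)
  have t: "0 \<le> t" "t \<le> T" and x: "0 \<le> x" "x \<le> R" using p tx by auto
  have min: "exp (- k * t) * w t x - \<epsilon> * x \<le> exp (- k * s) * w s y - \<epsilon> * y"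
    if "s \<in> {0..T}" "y \<in> {0..R}" for s y using p(2)[of "(s, y)"] that tx by auto
  have "exp (- k * t) * w t x - \<epsilon> * x \<le> exp (- k * T) * w T X - \<epsilon> * X"
    using min[of T X] assms \<open>X \<le> R\<close> by auto
  also have "\<dots> \<le> exp (- k * T) * w T X" using eps \<open>0 \<le> X\<close> by simp
  also have "\<dots> = - 2 * \<epsilon> * R" using R(1) by (simp add: \<epsilon>_def)
  finally have "exp (- k * t) * w t x \<le> \<epsilon> * x - 2 * \<epsilon> * R" by simp
  also have "\<dots> < 0" using mult_left_mono[OF x(2), of \<epsilon>] mult_pos_pos[OF eps R(1)] eps by linarith
  finally have wneg: "w t x < 0" by (simp add: mult_less_0_iff)
  then have xz: "x < z t" using w_outside t by (metis less_irrefl not_le)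
  have "t \<noteq> 0" using wneg w_init x init xz z_init by (auto simp: initial_datum_def)
  then have "t > 0" using t by auto
  have zR: "z t \<le> R" using R t by auto
  show False
  proof (cases "x = 0")
    case True
    have "((\<lambda>y. - (exp (- k * t) * w t y - \<epsilon> * y)) has_real_derivative - (exp (- k * t) * wx t 0 - \<epsilon>)) (at 0 within {0..z t})"
      using xz \<open>t > 0\<close> True by (auto intro!: derivative_eq_intros w_x)
    then have "- (exp (- k * t) * wx t 0 - \<epsilon>) \<le> 0"
    proof (rule right_derivative_nonpos_at_max)
      show "- (exp (- k * t) * w t y - \<epsilon> * y) \<le> - (exp (- k * t) * w t 0 - \<epsilon> * 0)"
        if "0 < y" "y < 0 + 1" "y \<le> z t" for y
        using min[of t y] that t zR True by auto
    qed (use xz True in auto)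
    with eps neumann[OF \<open>t > 0\<close>] show False by simp
  next
    case False
    then have "x > 0" using x by simp
    define e where "e = min x (z t - x)"
    have "e > 0" using \<open>x > 0\<close> xz by (auto simp: e_def)
    have e: "0 < y" "y < z t" if "\<bar>y - x\<bar> < e" for y
      using that unfolding e_def by linarith+
    have "- (exp (- k * t) * wxx t x) \<le> 0"
    proof (rule second_derivative_nonpos_at_local_max[OF \<open>e > 0\<close>])
      show "((\<lambda>y. - (exp (- k * t) * w t y - \<epsilon> * y)) has_real_derivative - (exp (- k * t) * wx t y - \<epsilon>)) (at y)"
        if "\<bar>y - x\<bar> < e" for y
        using e[OF that] \<open>t > 0\<close> by (auto intro!: derivative_eq_intros w_x_interior)
      show "((\<lambda>y. - (exp (- k * t) * wx t y - \<epsilon>)) has_real_derivative - (exp (- k * t) * wxx t x)) (at x)"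
        using \<open>t > 0\<close> \<open>x > 0\<close> xz by (auto intro!: derivative_eq_intros w_xx)
      show "- (exp (- k * t) * w t y - \<epsilon> * y) \<le> - (exp (- k * t) * w t x - \<epsilon> * x)"
        if "\<bar>y - x\<bar> < e" for y
        using min[of t y] e[OF that] t zR by auto
    qed
    then have "wxx t x \<ge> 0" by (simp add: zero_le_mult_iff)
    have "- (exp (- k * t) * (wt t x - k * w t x)) \<ge> 0"
    proof (rule DERIV_nonneg_of_left_le)
      show "((\<lambda>s. - (exp (- k * s) * w s x - \<epsilon> * x)) has_real_derivative - (exp (- k * t) * (wt t x - k * w t x))) (at t)"
        using \<open>t > 0\<close> \<open>x > 0\<close> xz by (auto intro!: derivative_eq_intros w_t simp: algebra_simps)
      show "t > 0" by fact
      show "- (exp (- k * s) * w s x - \<epsilon> * x) \<le> - (exp (- k * t) * w t x - \<epsilon> * x)" if "t - t < s" "s < t" for s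
        using min[of s x] t x that by auto
    qed
    then have "wt t x \<le> k * w t x" by (auto simp: mult_le_0_iff)
    moreover have "wt t x \<ge> Q * w t x"
      using pde[OF \<open>t > 0\<close> \<open>x > 0\<close> xz] Q[OF \<open>t > 0\<close> t(2) \<open>x > 0\<close> xz wneg] \<open>wxx t x \<ge> 0\<close> D_pos
      by (smt (verit) mult_nonneg_nonneg)
    ultimately show False using wneg by (simp add: k_def algebra_simps)
  qed
qed

lemma z_mono_pos:
  assumes w: "\<And>t x. 0 \<le> t \<Longrightarrow> 0 \<le> x \<Longrightarrow> 0 \<le> w t x"
  shows "0 \<le> s \<Longrightarrow> s \<le> t \<Longrightarrow> z s \<le> z t" and "0 \<le> t \<Longrightarrow> 0 < z t"
    and "0 < t \<Longrightarrow> wx t (z t) \<le> 0"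
proof -
  have flux: "wx t (z t) \<le> 0" if t: "0 < t" "0 < z t" for t
  proof (rule ccontr)
    assume pos: "\<not> wx t (z t) \<le> 0"
    have "(w t has_real_derivative wx t (z t)) (at (z t) within {0..z t})"
      using t by (intro w_x) auto
    with pos obtain d where d: "d > 0" "\<And>h. h > 0 \<Longrightarrow> z t - h \<in> {0..z t} \<Longrightarrow> h < d \<Longrightarrow> w t (z t - h) < w t (z t)"
      using has_real_derivative_pos_inc_left by (metis not_le)
    define h where "h = min d (z t) / 2"
    have "h > 0" "h < d" "z t - h \<in> {0..z t}" using d(1) t by (auto simp: h_def field_simps)
    with d(2)[of h] w[of t "z t - h"] w_outside[of t "z t"] t show False by auto
  qed
  have mono: "z s \<le> z t" if "0 \<le> s" "s \<le> t" and pos: "\<And>r. s < r \<Longrightarrow> r < t \<Longrightarrow> 0 < z r" for s t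
  proof (rule DERIV_nonneg_imp_increasing_open[OF \<open>s \<le> t\<close>])
    fix r assume r: "s < r" "r < t"
    then show "\<exists>y. DERIV z r :> y \<and> 0 \<le> y"
      using stefan[of r] flux[of r] pos[of r] \<kappa>_pos \<open>0 \<le> s\<close>
      by (intro exI[of _ "- \<kappa> * wx r (z r)"]) (auto simp: mult_le_0_iff)
  next
    show "continuous_on {s..t} z" using that by (intro continuous_on_subset[OF z_cont]) auto
  qed
  show pos: "0 < z t" if "0 \<le> t" for t
  proof (rule ccontr)
    assume "\<not> 0 < z t"
    define S where "S = {s\<in>{0..t}. z s \<le> 0}"
    have "closed S" unfolding S_def
      by (intro continuous_on_closed_Collect_le continuous_intros continuous_on_subset[OF z_cont]) auto
    moreover have "t \<in> S" using \<open>\<not> 0 < z t\<close> that by (auto simp: S_def)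
    moreover have bdd: "bdd_below S" by (rule bdd_belowI[of _ 0]) (auto simp: S_def)
    ultimately have c: "Inf S \<in> S" using closed_contains_Inf by blast
    have "z 0 \<le> z (Inf S)"
    proof (rule mono)
      fix r assume r: "0 < r" "r < Inf S"
      then have "r \<notin> S" using bdd cInf_lower by fastforce
      then show "0 < z r" using r c by (auto simp: S_def)
    qed (use c in \<open>auto simp: S_def\<close>)
    with c z0_pos z_init show False by (auto simp: S_def)
  qed
  show "0 \<le> s \<Longrightarrow> s \<le> t \<Longrightarrow> z s \<le> z t" using mono pos by auto
  show "0 < t \<Longrightarrow> wx t (z t) \<le> 0" using flux pos by auto
qed

lemma w_bounded_above:
  assumes B: "0 \<le> B" "\<And>x. 0 \<le> x \<Longrightarrow> w0 x \<le> B"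
    and F: "\<And>t x. 0 < t \<Longrightarrow> 0 < x \<Longrightarrow> x < z t \<Longrightarrow> B < w t x \<Longrightarrow> F t x < 0"
    and "0 \<le> T" "0 \<le> X"
  shows "w T X \<le> B"
proof (rule ccontr)
  assume neg: "\<not> w T X \<le> B"
  obtain R where R: "R > 0" "\<And>t. t \<in> {0..T} \<Longrightarrow> z t \<le> R" using z_bounded_on by blast
  define \<epsilon> where "\<epsilon> = (w T X - B) / (2 * R)"
  have eps: "\<epsilon> > 0" using neg R by (auto simp: \<epsilon>_def field_simps)
  have "X \<le> R" using R(2)[of T] neg w_outside[of T X] \<open>0 \<le> T\<close> B(1)
    by (smt (verit) atLeastAtMost_iff)
  let ?f = "\<lambda>p. w (fst p) (snd p) + \<epsilon> * snd p"
  have "continuous_on ({0..T} \<times> {0..R}) ?f"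
    by (intro continuous_intros continuous_on_subset[OF w_continuous]) auto
  moreover have "compact ({0..T} \<times> {0..R})" by (intro compact_Times compact_Icc)
  moreover have "(T, X) \<in> {0..T} \<times> {0..R}" using assms \<open>X \<le> R\<close> by auto
  ultimately obtain p where p: "p \<in> {0..T} \<times> {0..R}" "\<And>y. y \<in> {0..T} \<times> {0..R} \<Longrightarrow> ?f y \<le> ?f p"
    using continuous_attains_sup[of "{0..T} \<times> {0..R}" ?f] by blast
  obtain t x where tx: "p = (t, x)" by (cases p)
  have t: "0 \<le> t" "t \<le> T" and x: "0 \<le> x" "x \<le> R" using p tx by auto
  have max: "w s y + \<epsilon> * y \<le> w t x + \<epsilon> * x"
    if "s \<in> {0..T}" "y \<in> {0..R}" for s y using p(2)[of "(s, y)"] that tx by auto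
  have "B + 2 * \<epsilon> * R = w T X" using R(1) by (simp add: \<epsilon>_def field_simps)
  also have "\<dots> \<le> w T X + \<epsilon> * X" using eps \<open>0 \<le> X\<close> by simp
  also have "\<dots> \<le> w t x + \<epsilon> * x"
    using max[of T X] assms \<open>X \<le> R\<close> by auto
  also have "\<dots> \<le> w t x + \<epsilon> * R" using x eps by simp
  finally have "B + \<epsilon> * R \<le> w t x" by linarith
  moreover have "\<epsilon> * R > 0" using eps R by simp
  ultimately have wB: "B < w t x" by linarith
  then have xz: "x < z t" using w_outside t B(1) by (metis less_le_not_le not_le)
  have "t \<noteq> 0" using wB w_init[OF x(1)] B(2)[OF x(1)] by auto
  then have "t > 0" using t by auto
  have zR: "z t \<le> R" using R t by auto
  show False
  proof (cases "x = 0")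
    case True
    have "((\<lambda>y. w t y + \<epsilon> * y) has_real_derivative wx t 0 + \<epsilon>) (at 0 within {0..z t})"
      using xz \<open>t > 0\<close> True by (auto intro!: derivative_eq_intros w_x)
    then have "wx t 0 + \<epsilon> \<le> 0"
      by (rule right_derivative_nonpos_at_max[where e = 1]) (use max t xz zR True in auto)
    with eps neumann[OF \<open>t > 0\<close>] show False by simp
  next
    case False
    then have "x > 0" using x by simp
    define e where "e = min x (z t - x)"
    have "e > 0" using \<open>x > 0\<close> xz by (auto simp: e_def)
    have e: "0 < y" "y < z t" if "\<bar>y - x\<bar> < e" for y
      using that unfolding e_def by linarith+
    have "wxx t x \<le> 0"
    proof (rule second_derivative_nonpos_at_local_max[OF \<open>e > 0\<close>])
      show "((\<lambda>y. w t y + \<epsilon> * y) has_real_derivative wx t y + \<epsilon>) (at y)"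
        if "\<bar>y - x\<bar> < e" for y
        using e[OF that] \<open>t > 0\<close> by (auto intro!: derivative_eq_intros w_x_interior)
      show "((\<lambda>y. wx t y + \<epsilon>) has_real_derivative wxx t x) (at x)"
        using \<open>t > 0\<close> \<open>x > 0\<close> xz by (auto intro!: derivative_eq_intros w_xx)
      show "w t y + \<epsilon> * y \<le> w t x + \<epsilon> * x"
        if "\<bar>y - x\<bar> < e" for y
        using max[of t y] e[OF that] t zR by auto
    qed
    moreover have "wt t x \<ge> 0"
    proof (rule DERIV_nonneg_of_left_le)
      show "((\<lambda>s. w s x) has_real_derivative wt t x) (at t)"
        using \<open>t > 0\<close> \<open>x > 0\<close> xz by (rule w_t)
      show "t > 0" by fact
      show "w s x \<le> w t x" if "t - t < s" "s < t" for s
        using max[of s x] t x that by auto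
    qed
    ultimately show False
      using pde[OF \<open>t > 0\<close> \<open>x > 0\<close> xz] F[OF \<open>t > 0\<close> \<open>x > 0\<close> xz wB] D_pos
      by (smt (verit) mult_nonneg_nonpos)
  qed
qed

text \<open>
  At a positive maximum of \<open>w t x - w t y - \<psi> (y - x)\<close>, moving \<open>x\<close> and \<open>y\<close> towards each other gives
  \<open>wxx t x - wxx t y \<le> 4 \<psi>''\<close>, which contradicts the equation when \<open>-\<psi>''\<close> is large. If \<open>y\<close> lies on or
  beyond the boundary, the monotonicity of \<open>z\<close> makes \<open>w s y = 0\<close> for all earlier \<open>s\<close>, and varying \<open>x\<close>
  alone suffices.
\<close>

lemma w_one_sided_lipschitz:
  assumes nonneg: "\<And>t x. 0 \<le> t \<Longrightarrow> 0 \<le> x \<Longrightarrow> 0 \<le> w t x"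
    and M: "0 < M" "\<And>t x. 0 \<le> t \<Longrightarrow> 0 \<le> x \<Longrightarrow> w t x \<le> M"
    and A: "\<And>t x. 0 < t \<Longrightarrow> 0 < x \<Longrightarrow> x < z t \<Longrightarrow> \<bar>F t x\<bar> \<le> A"
  shows "\<exists>L>0. \<forall>t x y. 0 \<le> t \<longrightarrow> 0 \<le> x \<longrightarrow> x \<le> y \<longrightarrow> w t x - w t y \<le> L * (y - x)"
proof -
  have z_mono: "z s \<le> z t" if "0 \<le> s" "s \<le> t" for s t using z_mono_pos(1)[OF nonneg] that by auto
  obtain L0 where L0: "L0 > 0" "\<And>x y. 0 \<le> x \<Longrightarrow> x \<le> y \<Longrightarrow> w0 x - w0 y \<le> L0 * (y - x)"
    using initial_datum_lipschitz[OF init] by blast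
  define K where "K = 1 + L0 / M + \<bar>A\<bar> / (2 * M * D)"
  have K1: "K \<ge> 1" using L0 M D_pos by (auto simp: K_def intro!: add_nonneg_nonneg)
  have KL: "L0 \<le> M * K" using L0 M D_pos by (simp add: K_def field_simps)
  have "\<bar>A\<bar> < 2 * M * D * K"
    using L0 M D_pos by (simp add: K_def field_simps add_pos_pos)
  also have "\<dots> \<le> 2 * M * D * K * K" using K1 M D_pos by simp
  finally have KA: "A < 2 * D * M * K\<^sup>2" by (simp add: power2_eq_square mult_ac)
  define \<psi> where "\<psi> s = M * (2 * K * s - K\<^sup>2 * s\<^sup>2)" for s
  define \<psi>' where "\<psi>' s = 2 * M * K * (1 - K * s)" for s
  have d\<psi>: "(\<psi> has_real_derivative \<psi>' s) (at s)" for s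
    unfolding \<psi>_def \<psi>'_def by (auto intro!: derivative_eq_intros simp: algebra_simps power2_eq_square)
  have d\<psi>': "(\<psi>' has_real_derivative - 2 * M * K\<^sup>2) (at s)" for s
    unfolding \<psi>'_def by (auto intro!: derivative_eq_intros simp: algebra_simps power2_eq_square)
  have \<psi>_le: "\<psi> s \<le> 2 * M * K * s" for s using M by (simp add: \<psi>_def algebra_simps)
  have \<psi>_ge: "M * K * s \<le> \<psi> s" if "0 \<le> s" "s \<le> 1 / K" for s
  proof -
    have "K * s * (K * s) \<le> K * s * 1" using that K1 by (intro mult_left_mono) (auto simp: field_simps)
    then have "M * (K * s * (K * s)) \<le> M * (K * s)" using M by simp
    then show ?thesis by (simp add: \<psi>_def power2_eq_square algebra_simps)
  qed
  have \<psi>_end: "\<psi> (1 / K) = M" using K1 by (simp add: \<psi>_def power2_eq_square)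
  have key: "w T X - w T Y \<le> \<psi> (Y - X)" if TXY: "0 \<le> T" "0 \<le> X" "X \<le> Y" "Y - X \<le> 1 / K" for T X Y
  proof (rule ccontr)
    assume neg: "\<not> w T X - w T Y \<le> \<psi> (Y - X)"
    obtain R where R: "R > 0" "\<And>t. t \<in> {0..T} \<Longrightarrow> z t \<le> R" using z_bounded_on by blast
    define R' where "R' = R + 1 / K"
    have \<psi>_nonneg: "0 \<le> \<psi> s" if "0 \<le> s" "s \<le> 1 / K" for s
      using \<psi>_ge[OF that] M K1 that by (smt (verit) mult_nonneg_nonneg)
    have pos_imp: "x < z t" if "0 \<le> t" "0 \<le> x" "x \<le> y" "y - x \<le> 1 / K" "\<psi> (y - x) < w t x - w t y" for t x y
    proof -
      have "0 < w t x" using \<psi>_nonneg[of "y - x"] nonneg[of t y] that by auto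
      then show ?thesis using w_outside[of t x] that by (metis less_irrefl not_le)
    qed
    define S where "S = ({0..T} \<times> {0..R'} \<times> {0..R'}) \<inter> {p. fst (snd p) \<le> snd (snd p) \<and> snd (snd p) - fst (snd p) \<le> 1 / K}"
    let ?f = "\<lambda>p. w (fst p) (fst (snd p)) - w (fst p) (snd (snd p)) - \<psi> (snd (snd p) - fst (snd p))"
    have "compact S" unfolding S_def
      by (intro compact_Int_closed compact_Times compact_Icc closed_Collect_conj closed_Collect_le continuous_intros)
    moreover have "continuous_on S ?f"
    proof (intro continuous_on_diff)
      show "continuous_on S (\<lambda>p. w (fst p) (fst (snd p)))"
        by (rule continuous_on_compose2[OF w_continuous, of _ "\<lambda>p. (fst p, fst (snd p))", simplified])
           (auto intro!: continuous_intros simp: S_def)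
      show "continuous_on S (\<lambda>p. w (fst p) (snd (snd p)))"
        by (rule continuous_on_compose2[OF w_continuous, of _ "\<lambda>p. (fst p, snd (snd p))", simplified])
           (auto intro!: continuous_intros simp: S_def)
      show "continuous_on S (\<lambda>p. \<psi> (snd (snd p) - fst (snd p)))"
        unfolding \<psi>_def by (intro continuous_intros)
    qed
    moreover have TS: "(T, X, Y) \<in> S"
      using pos_imp[of T X Y] TXY neg R(2)[of T] by (auto simp: S_def R'_def)
    ultimately obtain p where p: "p \<in> S" "\<And>q. q \<in> S \<Longrightarrow> ?f q \<le> ?f p"
      using continuous_attains_sup[of S ?f] by blast
    obtain t x y where txy: "p = (t, x, y)" by (cases p)
    have t: "0 \<le> t" "t \<le> T" and xy: "0 \<le> x" "x \<le> y" "y - x \<le> 1 / K" using p(1) by (auto simp: txy S_def)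
    have max: "w s x' - w s y' - \<psi> (y' - x') \<le> w t x - w t y - \<psi> (y - x)"
      if "0 \<le> s" "s \<le> T" "0 \<le> x'" "x' \<le> y'" "y' \<le> R'" "y' - x' \<le> 1 / K" for s x' y'
      using p(2)[of "(s, x', y')"] that by (auto simp: S_def txy)
    have "\<psi> (y - x) < w t x - w t y" using p(2)[OF TS] neg by (simp add: txy)
    note pos = this
    have xz: "x < z t" using pos_imp t xy pos by blast
    have zR: "z t \<le> R" using R t by auto
    have "x \<noteq> y" using pos by (auto simp: \<psi>_def)
    then have "x < y" using xy by auto
    have "y - x \<noteq> 1 / K" using pos \<psi>_end M(2)[of t x] nonneg[of t y] t xy by auto
    then have yx: "y - x < 1 / K" using xy by auto
    have yR: "y < R'" using yx xz zR by (simp add: R'_def)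
    have "t \<noteq> 0"
    proof
      assume "t = 0"
      then have "w t x - w t y \<le> L0 * (y - x)" using w_init L0 xy by auto
      also have "\<dots> \<le> M * K * (y - x)" using KL xy by (intro mult_right_mono) auto
      also have "\<dots> \<le> \<psi> (y - x)" using \<psi>_ge xy by auto
      finally show False using pos by simp
    qed
    then have "t > 0" using t by simp
    have "x \<noteq> 0"
    proof
      assume "x = 0"
      have "((\<lambda>r. w t r - \<psi> (y - r)) has_real_derivative wx t 0 + \<psi>' y) (at 0 within {0..z t})"
        using xz \<open>t > 0\<close> \<open>x = 0\<close>
        by (auto intro!: derivative_eq_intros w_x has_field_derivative_at_within[OF DERIV_chain2[OF d\<psi>]])
      then have "wx t 0 + \<psi>' y \<le> 0"
      proof (rule right_derivative_nonpos_at_max)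
        show "w t r - \<psi> (y - r) \<le> w t 0 - \<psi> (y - 0)" if "0 < r" "r < 0 + y" "r \<le> z t" for r
          using max[of t r y] that t yR yx \<open>x = 0\<close> by auto
      qed (use xz \<open>x = 0\<close> \<open>x < y\<close> in auto)
      moreover have "0 < \<psi>' y" using yx \<open>x = 0\<close> M K1 by (simp add: \<psi>'_def field_simps)
      ultimately show False using neumann[OF \<open>t > 0\<close>] by simp
    qed
    then have "x > 0" using xy by simp
    show False
    proof (cases "y < z t")
      case True
      define e where "e = min (min x (z t - y)) (min ((y - x) / 2) ((1 / K - (y - x)) / 2))"
      have "e > 0" using \<open>x > 0\<close> True \<open>x < y\<close> yx by (auto simp: e_def)
      have e: "0 < x + r" "y - r < z t" "x + r < y - r" "y - x - 2 * r < 1 / K" if "\<bar>r - 0\<bar> < e" for r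
        using that unfolding e_def by (auto simp: abs_less_iff field_simps)
      have "wxx t x - wxx t y + 8 * M * K\<^sup>2 \<le> 0"
      proof (rule second_derivative_nonpos_at_local_max[OF \<open>e > 0\<close>])
        show "((\<lambda>r. w t (x + r) - w t (y - r) - \<psi> (y - x - 2 * r)) has_real_derivative
                 wx t (x + r) + wx t (y - r) + 2 * \<psi>' (y - x - 2 * r)) (at r)" if "\<bar>r - 0\<bar> < e" for r
          using e[OF that] \<open>t > 0\<close>
          by (auto intro!: derivative_eq_intros DERIV_chain2[OF w_x_interior] DERIV_chain2[OF d\<psi>])
        show "((\<lambda>r. wx t (x + r) + wx t (y - r) + 2 * \<psi>' (y - x - 2 * r)) has_real_derivative
                 wxx t x - wxx t y + 8 * M * K\<^sup>2) (at 0)"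
          using \<open>x > 0\<close> \<open>x < y\<close> \<open>t > 0\<close> True xz
          by (auto intro!: derivative_eq_intros DERIV_chain2[OF w_xx] DERIV_chain2[OF d\<psi>'])
        show "w t (x + r) - w t (y - r) - \<psi> (y - x - 2 * r) \<le> w t (x + 0) - w t (y - 0) - \<psi> (y - x - 2 * 0)"
          if "\<bar>r - 0\<bar> < e" for r
          using max[of t "x + r" "y - r"] e[OF that] t zR K1 by (auto simp: R'_def algebra_simps intro: order.trans)
      qed
      then have "D * (wxx t x - wxx t y) \<le> D * (- 8 * M * K\<^sup>2)" using D_pos by (intro mult_left_mono) auto
      moreover have "wt t x - wt t y \<ge> 0"
      proof (rule DERIV_nonneg_of_left_le)
        show "((\<lambda>s. w s x - w s y) has_real_derivative wt t x - wt t y) (at t)"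
          using \<open>t > 0\<close> \<open>x > 0\<close> xz True \<open>x < y\<close> by (auto intro!: derivative_eq_intros w_t)
        show "t > 0" by fact
        show "w s x - w s y \<le> w t x - w t y" if "t - t < s" "s < t" for s
          using max[of s x y] t xy yR that by auto
      qed
      ultimately show False
        using pde[OF \<open>t > 0\<close> \<open>x > 0\<close> xz] pde[OF \<open>t > 0\<close> _ True] \<open>x > 0\<close> \<open>x < y\<close>
          A[OF \<open>t > 0\<close> \<open>x > 0\<close> xz] A[OF \<open>t > 0\<close> _ True] KA
        by (auto simp: algebra_simps)
    next
      case False
      define e where "e = min (min x (z t - x)) (1 / K - (y - x))"
      have "e > 0" using \<open>x > 0\<close> xz yx by (auto simp: e_def)
      have e: "0 < r" "r < z t" "y - r < 1 / K" if "\<bar>r - x\<bar> < e" for r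
        using that unfolding e_def by (auto simp: abs_less_iff)
      have "wxx t x + 2 * M * K\<^sup>2 \<le> 0"
      proof (rule second_derivative_nonpos_at_local_max[OF \<open>e > 0\<close>])
        show "((\<lambda>r. w t r - \<psi> (y - r)) has_real_derivative wx t r + \<psi>' (y - r)) (at r)" if "\<bar>r - x\<bar> < e" for r
          using e[OF that] \<open>t > 0\<close>
          by (auto intro!: derivative_eq_intros w_x_interior DERIV_chain2[OF d\<psi>])
        show "((\<lambda>r. wx t r + \<psi>' (y - r)) has_real_derivative wxx t x + 2 * M * K\<^sup>2) (at x)"
          using \<open>x > 0\<close> \<open>t > 0\<close> xz
          by (auto intro!: derivative_eq_intros w_xx DERIV_chain2[OF d\<psi>'])
        show "w t r - \<psi> (y - r) \<le> w t x - \<psi> (y - x)" if "\<bar>r - x\<bar> < e" for r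
          using max[of t r y] e[OF that] t yR False by auto
      qed
      then have "D * wxx t x \<le> D * (- 2 * M * K\<^sup>2)" using D_pos by (intro mult_left_mono) auto
      moreover have "wt t x \<ge> 0"
      proof (rule DERIV_nonneg_of_left_le)
        show "((\<lambda>s. w s x) has_real_derivative wt t x) (at t)"
          using \<open>t > 0\<close> \<open>x > 0\<close> xz by (rule w_t)
        show "t > 0" by fact
        show "w s x \<le> w t x" if "t - t < s" "s < t" for s
          using max[of s x y] t xy yR that w_outside[of s y] w_outside[of t y] z_mono[of s t] False by auto
      qed
      ultimately show False
        using pde[OF \<open>t > 0\<close> \<open>x > 0\<close> xz] A[OF \<open>t > 0\<close> \<open>x > 0\<close> xz] KA
        by (auto simp: algebra_simps)
    qed
  qed
  have "w t x - w t y \<le> 2 * M * K * (y - x)" if txy: "0 \<le> t" "0 \<le> x" "x \<le> y" for t x y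
  proof (cases "y - x \<le> 1 / K")
    case True
    then show ?thesis using key[of t x y] \<psi>_le[of "y - x"] txy by linarith
  next
    case False
    then have "1 \<le> K * (y - x)" using K1 by (simp add: field_simps)
    then have "M * 1 \<le> M * (K * (y - x))" using M(1) by (intro mult_left_mono) auto
    moreover have "2 * M * K * (y - x) = 2 * (M * (K * (y - x)))" by simp
    ultimately show ?thesis using M(1) nonneg[of t y] M(2)[of t x] txy by linarith
  qed
  then show ?thesis using M K1 by (intro exI[of _ "2 * M * K"]) auto
qed

definition mass :: "real \<Rightarrow> real \<Rightarrow> real \<Rightarrow> real \<Rightarrow> real" where
  "mass k a b t = integral {a..b} (\<lambda>x. exp (k * x) * w t x)"

definition flux :: "real \<Rightarrow> real \<Rightarrow> real \<Rightarrow> real" where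
  "flux k t x = D * exp (k * x) * (wx t x - k * w t x)"

lemma mass_integrable: "0 \<le> t \<Longrightarrow> 0 \<le> a \<Longrightarrow> (\<lambda>x. exp (k * x) * w t x) integrable_on {a..b}"
  by (intro integrable_continuous_interval continuous_intros w_continuous_x)

lemma mass_split: "0 \<le> t \<Longrightarrow> 0 \<le> a \<Longrightarrow> a \<le> c \<Longrightarrow> c \<le> b \<Longrightarrow> mass k a b t = mass k a c t + mass k c b t"
  unfolding mass_def by (subst Henstock_Kurzweil_Integration.integral_combine) (auto intro: mass_integrable)

lemma mass_continuous: "continuous_on {0..} (mass k 0 b)"
proof -
  have "continuous_on {0..} (\<lambda>t. integral (cbox 0 b) (\<lambda>x. exp (k * x) * w t x))"
    by (rule integral_continuous_on_param)
       (auto intro!: continuous_intros continuous_on_subset[OF w_continuous] simp: case_prod_beta)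
  then show ?thesis by (simp add: mass_def[abs_def])
qed

lemma mass_nonneg:
  assumes "\<And>t x. 0 \<le> t \<Longrightarrow> 0 \<le> x \<Longrightarrow> 0 \<le> w t x" "0 \<le> t" "0 \<le> a"
  shows "0 \<le> mass k a b t"
  unfolding mass_def using assms by (intro integral_nonneg mass_integrable) auto

lemma mass_le:
  assumes M: "0 \<le> M" "\<And>t x. 0 \<le> t \<Longrightarrow> 0 \<le> x \<Longrightarrow> w t x \<le> M"
    and "0 \<le> k" "0 \<le> t" "0 \<le> a" "a \<le> b" "b \<le> Z"
  shows "mass k a b t \<le> M * exp (k * Z) * (b - a)"
proof -
  have "mass k a b t \<le> integral {a..b} (\<lambda>x. exp (k * Z) * M)"
    unfolding mass_def
  proof (intro integral_le mass_integrable)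
    fix x assume "x \<in> {a..b}"
    then show "exp (k * x) * w t x \<le> exp (k * Z) * M"
      using assms by (intro order.trans[OF mult_left_mono mult_right_mono]) (auto intro!: mult_left_mono)
  qed (use assms in auto)
  also have "\<dots> = M * exp (k * Z) * (b - a)" using assms by simp
  finally show ?thesis .
qed

lemma mass_truncate:
  assumes M: "0 \<le> M" "\<And>t x. 0 \<le> t \<Longrightarrow> 0 \<le> x \<Longrightarrow> w t x \<le> M"
    and "0 \<le> k" "0 \<le> t" "0 \<le> a" "a \<le> b" "b \<le> z t" "z t \<le> Z"
  shows "mass k 0 Z t - M * exp (k * Z) * (a + (z t - b)) \<le> mass k a b t"
proof -
  have "mass k (z t) Z t = integral {z t..Z} (\<lambda>x. 0)"
    unfolding mass_def using assms by (intro integral_cong) (auto simp: w_outside)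
  then have 0: "mass k (z t) Z t = 0" by simp
  have "mass k 0 Z t = mass k 0 a t + mass k a b t + mass k b (z t) t + mass k (z t) Z t"
    using assms mass_split[of t 0 a Z] mass_split[of t a b Z] mass_split[of t b "z t" Z] by auto
  moreover have "mass k 0 a t \<le> M * exp (k * Z) * (a - 0)" using assms by (intro mass_le) auto
  moreover have "mass k b (z t) t \<le> M * exp (k * Z) * (z t - b)" using assms by (intro mass_le) auto
  ultimately show ?thesis using 0 by (simp add: algebra_simps)
qed

lemma mass_derivative_ge:
  assumes nonneg: "\<And>t x. 0 \<le> t \<Longrightarrow> 0 \<le> x \<Longrightarrow> 0 \<le> w t x"
    and F: "\<And>t x. 0 < t \<Longrightarrow> 0 < x \<Longrightarrow> x < z t \<Longrightarrow> - K * w t x \<le> F t x"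
    and k: "D * k\<^sup>2 = K + 1"
    and "0 < t" "t < s" "0 < a" "a \<le> b" "b < z t"
  shows "\<exists>r. t < r \<and> r < s \<and>
    (s - t) * (flux k r b - flux k r a + mass k a b r) \<le> mass k a b s - mass k a b t"
proof -
  have z_mono: "z t1 \<le> z t2" if "0 \<le> t1" "t1 \<le> t2" for t1 t2 using z_mono_pos(1)[OF nonneg] that by auto
  have bz: "b < z r" if "t \<le> r" for r using z_mono[of t r] that assms by auto
  let ?g = "\<lambda>r x. exp (k * x) * wt r x"
  have g_cont: "continuous_on ({t..s} \<times> cbox a b) (\<lambda>(r, x). ?g r x)"
    unfolding case_prod_beta using assms bz
    by (intro continuous_intros continuous_on_subset[OF wt_cont]) (auto intro: le_less_trans)
  have deriv: "(mass k a b has_real_derivative integral (cbox a b) (?g r)) (at r within {t..s})" if "r \<in> {t..s}" for r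
  proof -
    have "((\<lambda>r. integral (cbox a b) (\<lambda>x. exp (k * x) * w r x)) has_real_derivative integral (cbox a b) (?g r)) (at r within {t..s})"
    proof (rule leibniz_rule_field_derivative[OF _ _ g_cont that])
      fix r x assume "r \<in> {t..s}" "x \<in> cbox a b"
      then show "((\<lambda>r. exp (k * x) * w r x) has_real_derivative exp (k * x) * wt r x) (at r within {t..s})"
        using assms bz[of r] by (intro DERIV_cmult has_field_derivative_at_within[OF w_t]) auto
    next
      fix r assume "r \<in> {t..s}"
      then show "(\<lambda>x. exp (k * x) * w r x) integrable_on cbox a b"
        using assms by (auto intro!: mass_integrable)
    qed auto
    then show ?thesis by (simp add: mass_def[abs_def])
  qed
  have "\<exists>r\<in>{t<..<s}. mass k a b s - mass k a b t = (\<lambda>h. integral (cbox a b) (?g r) * h) (s - t)"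
    using deriv unfolding has_field_derivative_def by (intro mvt_simple \<open>t < s\<close>) auto
  then obtain r where r: "t < r" "r < s" and eq: "mass k a b s - mass k a b t = integral {a..b} (?g r) * (s - t)"
    by auto
  have r0: "r > 0" using r assms by auto
  have "flux k r b - flux k r a + mass k a b r \<le> integral {a..b} (?g r)"
  proof -
    have "((\<lambda>x. D * exp (k * x) * (wxx r x - k\<^sup>2 * w r x)) has_integral flux k r b - flux k r a) {a..b}"
    proof (rule fundamental_theorem_of_calculus[OF \<open>a \<le> b\<close>])
      fix x assume "x \<in> {a..b}"
      then have x: "0 < x" "x < z r" using assms bz[of r] r by auto
      have "(flux k r has_real_derivative D * exp (k * x) * (wxx r x - k\<^sup>2 * w r x)) (at x)"
        unfolding flux_def using x r0
        by (auto intro!: derivative_eq_intros w_x_interior w_xx simp: algebra_simps power2_eq_square)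
      then show "(flux k r has_vector_derivative D * exp (k * x) * (wxx r x - k\<^sup>2 * w r x)) (at x within {a..b})"
        using has_real_derivative_iff_has_vector_derivative has_field_derivative_at_within by blast
    qed
    moreover have "((\<lambda>x. exp (k * x) * w r x) has_integral mass k a b r) {a..b}"
      unfolding mass_def using assms r0 by (intro integrable_integral mass_integrable) auto
    ultimately have I: "((\<lambda>x. D * exp (k * x) * (wxx r x - k\<^sup>2 * w r x) + exp (k * x) * w r x)
        has_integral flux k r b - flux k r a + mass k a b r) {a..b}"
      by (rule has_integral_add)
    have "continuous_on {a..b} (?g r)"
      by (rule continuous_on_compose2[OF g_cont, of _ "\<lambda>x. (r, x)", simplified])
         (use r in \<open>auto intro!: continuous_intros\<close>)
    then have J: "(?g r has_integral integral {a..b} (?g r)) {a..b}"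
      by (intro integrable_integral integrable_continuous_interval)
    show ?thesis
    proof (rule has_integral_le[OF I J])
      fix x assume "x \<in> {a..b}"
      then have x: "0 < x" "x < z r" using assms bz[of r] r by auto
      have "D * (wxx r x - k\<^sup>2 * w r x) + w r x = D * wxx r x - (D * k\<^sup>2) * w r x + w r x"
        by (simp add: algebra_simps)
      also have "\<dots> = D * wxx r x - K * w r x" unfolding k by (simp add: algebra_simps)
      also have "\<dots> \<le> wt r x" using pde[OF r0 x] F[OF r0 x] by simp
      finally have "exp (k * x) * (D * (wxx r x - k\<^sup>2 * w r x) + w r x) \<le> ?g r x" by simp
      then show "D * exp (k * x) * (wxx r x - k\<^sup>2 * w r x) + exp (k * x) * w r x \<le> ?g r x"
        by (simp add: algebra_simps)
    qed
  qed
  then have "(s - t) * (flux k r b - flux k r a + mass k a b r) \<le> (s - t) * integral {a..b} (?g r)"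
    using \<open>t < s\<close> by (intro mult_left_mono) auto
  then show ?thesis using r eq by (auto simp: mult.commute)
qed

lemma flux_continuous:
  "continuous_on {p. 0 < fst p \<and> 0 \<le> snd p \<and> snd p \<le> z (fst p)} (\<lambda>p. flux k (fst p) (snd p))"
  unfolding flux_def
  by (intro continuous_intros wx_cont continuous_on_subset[OF w_continuous]) auto

text \<open>
  \<open>wt\<close> and \<open>wxx\<close> may be unbounded near the boundary, so the mass is differentiated on a fixed interval
  inside \<open>(0, z t)\<close>; letting the interval grow only yields a bound for a right Dini derivative.
\<close>

lemma mass_Dini:
  assumes nonneg: "\<And>t x. 0 \<le> t \<Longrightarrow> 0 \<le> x \<Longrightarrow> 0 \<le> w t x"
    and M: "0 \<le> M" "\<And>t x. 0 \<le> t \<Longrightarrow> 0 \<le> x \<Longrightarrow> w t x \<le> M"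
    and F: "\<And>t x. 0 < t \<Longrightarrow> 0 < x \<Longrightarrow> x < z t \<Longrightarrow> - K * w t x \<le> F t x"
    and k: "0 \<le> k" "D * k\<^sup>2 = K + 1"
    and Z: "\<And>t. 0 \<le> t \<Longrightarrow> z t \<le> Z"
    and C: "C = D * exp (k * Z) / \<kappa>"
    and t: "0 < t" and "0 < \<eta>"
  shows "\<exists>e>0. \<forall>s. t < s \<and> s < t + e \<longrightarrow>
    (s - t) * (mass k 0 Z t - \<eta>) \<le> (mass k 0 Z s + C * z s) - (mass k 0 Z t + C * z t)"
proof -
  note zprops = z_mono_pos[OF nonneg]
  have z_mono: "z r \<le> z s" if "0 \<le> r" "r \<le> s" for r s using zprops(1) that by auto
  have zt: "0 < z t" using zprops(2) t by auto
  have wxz: "wx t (z t) \<le> 0" using zprops(3) t by auto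
  have C0: "C > 0" using C D_pos \<kappa>_pos by simp
  define \<delta> where "\<delta> = \<eta> / 8"
  have \<delta>: "\<delta> > 0" using \<open>0 < \<eta>\<close> by (simp add: \<delta>_def)
  define B where "B = M * exp (k * Z) + 1"
  have B: "B > 0" using M(1) by (auto simp: B_def intro!: add_nonneg_pos)
  let ?N = "mass k 0 Z" and ?zd = "- \<kappa> * wx t (z t)"
  let ?\<Omega> = "{p. 0 < fst p \<and> 0 \<le> snd p \<and> snd p \<le> z (fst p)}"
  have near: "\<exists>\<rho>>0. \<forall>r y. 0 < r \<longrightarrow> 0 \<le> y \<longrightarrow> y \<le> z r \<longrightarrow> \<bar>r - t\<bar> < \<rho> \<longrightarrow> \<bar>y - x\<bar> < \<rho> \<longrightarrow> \<bar>flux k r y - flux k t x\<bar> < \<delta>"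
    if x: "0 \<le> x" "x \<le> z t" for x
  proof -
    obtain \<rho> where \<rho>: "\<rho> > 0" "\<And>p. p \<in> ?\<Omega> \<Longrightarrow> dist p (t, x) < \<rho> \<Longrightarrow> \<bar>flux k (fst p) (snd p) - flux k t x\<bar> < \<delta>"
      using flux_continuous[of k, unfolded continuous_on_iff, rule_format, of "(t, x)" \<delta>] t x \<delta>
      by (auto simp: dist_real_def)
    have "\<bar>flux k r y - flux k t x\<bar> < \<delta>"
      if "0 < r" "0 \<le> y" "y \<le> z r" "\<bar>r - t\<bar> < \<rho> / 2" "\<bar>y - x\<bar> < \<rho> / 2" for r y
    proof -
      have "dist (r, y) (t, x) \<le> \<bar>r - t\<bar> + \<bar>y - x\<bar>"
        unfolding dist_Pair_Pair dist_real_def by (rule sqrt_sum_squares_le_sum_abs[THEN order.trans]) simp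
      then show ?thesis using \<rho>(2)[of "(r, y)"] that by auto
    qed
    then show ?thesis using \<rho>(1) by (intro exI[of _ "\<rho> / 2"]) auto
  qed
  obtain \<rho>1 where \<rho>1: "\<rho>1 > 0" "\<And>r y. 0 < r \<Longrightarrow> 0 \<le> y \<Longrightarrow> y \<le> z r \<Longrightarrow> \<bar>r - t\<bar> < \<rho>1 \<Longrightarrow> \<bar>y - z t\<bar> < \<rho>1 \<Longrightarrow> \<bar>flux k r y - flux k t (z t)\<bar> < \<delta>"
    using near[of "z t"] zt by auto
  obtain \<rho>2 where \<rho>2: "\<rho>2 > 0" "\<And>r y. 0 < r \<Longrightarrow> 0 \<le> y \<Longrightarrow> y \<le> z r \<Longrightarrow> \<bar>r - t\<bar> < \<rho>2 \<Longrightarrow> \<bar>y - 0\<bar> < \<rho>2 \<Longrightarrow> \<bar>flux k r y - flux k t 0\<bar> < \<delta>"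
    using near[of 0] zt by auto
  obtain \<rho>3 where \<rho>3: "\<rho>3 > 0" "\<And>r. 0 \<le> r \<Longrightarrow> \<bar>r - t\<bar> < \<rho>3 \<Longrightarrow> \<bar>?N r - ?N t\<bar> < \<delta>"
    using mass_continuous[of k Z, unfolded continuous_on_iff, rule_format, of t \<delta>] t \<delta>
    by (auto simp: dist_real_def)
  obtain \<rho>4 where \<rho>4: "\<rho>4 > 0" "\<And>r. 0 \<le> r \<Longrightarrow> \<bar>r - t\<bar> < \<rho>4 \<Longrightarrow> \<bar>z r - z t\<bar> < \<delta> / B"
    using z_cont[unfolded continuous_on_iff, rule_format, of t "\<delta> / B"] t \<delta> B
    by (auto simp: dist_real_def)
  have "((\<lambda>s. z s - (?zd - \<delta> / C) * s) has_real_derivative \<delta> / C) (at t)"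
    using stefan[OF t] by (auto intro!: derivative_eq_intros)
  from DERIV_pos_inc_right[OF this] \<delta> C0 obtain \<rho>5 where \<rho>5: "\<rho>5 > 0"
    "\<And>h. h > 0 \<Longrightarrow> h < \<rho>5 \<Longrightarrow> z t - (?zd - \<delta> / C) * t < z (t + h) - (?zd - \<delta> / C) * (t + h)"
    by auto
  define e where "e = Min {\<rho>1, \<rho>2, \<rho>3, \<rho>4, \<rho>5}"
  have e: "e > 0" "e \<le> \<rho>1" "e \<le> \<rho>2" "e \<le> \<rho>3" "e \<le> \<rho>4" "e \<le> \<rho>5"
    using \<rho>1(1) \<rho>2(1) \<rho>3(1) \<rho>4(1) \<rho>5(1) by (auto simp: e_def)
  have "(s - t) * (?N t - \<eta>) \<le> (?N s + C * z s) - (?N t + C * z t)" if s: "t < s" "s < t + e" for s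
  proof -
    define a where "a = Min {\<rho>1, \<rho>2, z t, \<delta> / B, (s - t) * \<delta> / B} / 2"
    have a: "0 < a" "a < \<rho>1" "a < \<rho>2" "2 * a \<le> z t" "2 * a \<le> \<delta> / B" "2 * a \<le> (s - t) * \<delta> / B"
    proof -
      let ?S = "{\<rho>1, \<rho>2, z t, \<delta> / B, (s - t) * \<delta> / B}"
      have "\<And>y. y \<in> ?S \<Longrightarrow> Min ?S \<le> y" by (intro Min_le) auto
      moreover have "0 < Min ?S" using \<rho>1(1) \<rho>2(1) zt \<delta> B s by (subst Min_gr_iff) auto
      ultimately show "0 < a" "a < \<rho>1" "a < \<rho>2" "2 * a \<le> z t" "2 * a \<le> \<delta> / B" "2 * a \<le> (s - t) * \<delta> / B"
        unfolding a_def using \<rho>1(1) \<rho>2(1) by (auto simp: field_simps)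
    qed
    have aB: "B * (2 * a) \<le> \<delta>" "B * (2 * a) \<le> (s - t) * \<delta>" using a(5,6) B by (auto simp: field_simps)
    define b where "b = z t - a"
    have b: "a \<le> b" "b < z t" using a by (auto simp: b_def)
    obtain r where r: "t < r" "r < s" and
      le: "(s - t) * (flux k r b - flux k r a + mass k a b r) \<le> mass k a b s - mass k a b t"
      using mass_derivative_ge[OF nonneg F k(2) t s(1) a(1) b] by blast
    have zr: "z t \<le> z r" "z t \<le> z s" using z_mono r t by auto
    have rt: "\<bar>r - t\<bar> < e" "0 < r" using r s t by auto
    have trunc: "?N q - B * (a + (z q - b)) \<le> mass k a b q" if "0 \<le> q" "z t \<le> z q" for q
    proof -
      have "M * exp (k * Z) * (a + (z q - b)) \<le> B * (a + (z q - b))"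
        using that a b by (intro mult_right_mono) (auto simp: B_def)
      then show ?thesis
        using mass_truncate[OF M k(1) that(1), of a b Z] a(1) b that Z[OF that(1)] by linarith
    qed
    have 1: "flux k t (z t) - \<delta> \<le> flux k r b"
      using \<rho>1(2)[of r b] rt e a b zr by (auto simp: b_def abs_less_iff)
    have 2: "flux k r a \<le> flux k t 0 + \<delta>"
      using \<rho>2(2)[of r a] rt e a b zr by (auto simp: abs_less_iff)
    have 3: "flux k t 0 \<le> 0"
      using neumann[OF t] nonneg[of t 0] t k(1) D_pos by (simp add: flux_def)
    have 4: "- C * ?zd \<le> flux k t (z t)"
    proof -
      have "D * exp (k * Z) * wx t (z t) \<le> D * exp (k * z t) * wx t (z t)"
        using wxz D_pos Z[of t] t k(1) by (intro mult_right_mono_neg) (auto intro!: mult_left_mono)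
      moreover have "- C * ?zd = D * exp (k * Z) * wx t (z t)" using C \<kappa>_pos by simp
      moreover have "flux k t (z t) = D * exp (k * z t) * wx t (z t)" using t by (simp add: flux_def w_outside)
      ultimately show ?thesis by argo
    qed
    have 5: "?N t - 3 * \<delta> \<le> mass k a b r"
    proof -
      have "B * (z r - z t) \<le> \<delta>" using \<rho>4(2)[of r] rt e B by (auto simp: field_simps abs_less_iff)
      then have "B * (a + (z r - b)) \<le> 2 * \<delta>" using aB(1) by (simp add: b_def algebra_simps)
      then show ?thesis using trunc[of r] \<rho>3(2)[of r] rt e zr by (auto simp: abs_less_iff)
    qed
    have 6: "?N t - (s - t) * \<delta> \<le> mass k a b t"
      using trunc[of t] aB(2) t by (simp add: b_def algebra_simps)
    have "b \<le> Z" using b Z[of t] t by simp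
    then have "?N s = mass k 0 a s + mass k a b s + mass k b Z s"
      using mass_split[of s 0 a Z k] mass_split[of s a b Z k] a b s t by auto
    then have 7: "mass k a b s \<le> ?N s"
      using mass_nonneg[OF nonneg, where t = s and a = 0 and b = a and k = k]
        mass_nonneg[OF nonneg, where t = s and a = b and b = Z and k = k] a b s t by auto
    have "(s - t) * (?N t - C * ?zd - 6 * \<delta>) \<le> (s - t) * (flux k r b - flux k r a + mass k a b r)"
      using 1 2 3 4 5 s \<delta> by (intro mult_left_mono) auto
    then have "(s - t) * (?N t - C * ?zd - 6 * \<delta>) - (s - t) * \<delta> \<le> ?N s - ?N t"
      using le 6 7 by linarith
    moreover have "(s - t) * (C * ?zd - \<delta>) \<le> C * z s - C * z t"
    proof -
      have "(s - t) * (?zd - \<delta> / C) \<le> z s - z t"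
        using \<rho>5(2)[of "s - t"] s e by (simp add: algebra_simps diff_divide_distrib)
      then have "C * ((s - t) * (?zd - \<delta> / C)) \<le> C * (z s - z t)" using C0 by (intro mult_left_mono) auto
      moreover have "C * ((s - t) * (?zd - \<delta> / C)) = (s - t) * (C * ?zd - \<delta>)"
        using C0 by (simp add: field_simps)
      ultimately show ?thesis by (simp add: algebra_simps)
    qed
    moreover have "(s - t) * (?N t - C * ?zd - 6 * \<delta>) - (s - t) * \<delta> + (s - t) * (C * ?zd - \<delta>) = (s - t) * (?N t - \<eta>)"
      by (simp add: \<delta>_def field_simps)
    ultimately show ?thesis by linarith
  qed
  then show ?thesis using e(1) by blast
qed

lemma mass_le_remaining_distance:
  assumes nonneg: "\<And>t x. 0 \<le> t \<Longrightarrow> 0 \<le> x \<Longrightarrow> 0 \<le> w t x"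
    and M: "0 \<le> M" "\<And>t x. 0 \<le> t \<Longrightarrow> 0 \<le> x \<Longrightarrow> w t x \<le> M"
    and F: "\<And>t x. 0 < t \<Longrightarrow> 0 < x \<Longrightarrow> x < z t \<Longrightarrow> - K * w t x \<le> F t x"
    and k: "0 \<le> k" "D * k\<^sup>2 = K + 1"
    and Z: "\<And>t. 0 \<le> t \<Longrightarrow> z t \<le> Z"
    and C: "C = D * exp (k * Z) / \<kappa>"
    and t: "0 < t"
  shows "mass k 0 Z t \<le> C * (Z - z t)"
proof (rule ccontr)
  assume neg: "\<not> mass k 0 Z t \<le> C * (Z - z t)"
  define Y where "Y s = mass k 0 Z s + C * (z s - Z)" for s
  have C0: "C > 0" using C D_pos \<kappa>_pos by simp
  define y where "y = Y t"
  have y: "y > 0" using neg by (simp add: y_def Y_def algebra_simps)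
  have Y_cont: "continuous_on {t..s} Y" for s
    unfolding Y_def using t
    by (intro continuous_intros continuous_on_subset[OF mass_continuous] continuous_on_subset[OF z_cont]) auto
  have dini: "\<exists>e>0. \<forall>s. r < s \<and> s < r + e \<longrightarrow> (s - r) * (mass k 0 Z r - \<eta>) \<le> Y s - Y r"
    if "0 < r" "0 < \<eta>" for r \<eta>
    using mass_Dini[OF nonneg M F k Z C that] by (simp add: Y_def algebra_simps)
  have mono: "Y t \<le> Y s" if "t \<le> s" for s
  proof (rule right_Dini_nonneg_imp_le[OF that Y_cont])
    fix r \<eta> :: real assume r: "t \<le> r" "r < s" and "\<eta> > 0"
    then obtain e where e: "e > 0" "\<And>q. r < q \<Longrightarrow> q < r + e \<Longrightarrow> (q - r) * (mass k 0 Z r - \<eta>) \<le> Y q - Y r"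
      using dini[of r \<eta>] t by auto
    have "- \<eta> * (q - r) \<le> Y q - Y r" if q: "r < q" "q < r + e" for q
    proof -
      have "(q - r) * (- \<eta>) \<le> (q - r) * (mass k 0 Z r - \<eta>)"
        using q mass_nonneg[OF nonneg, of r 0 k Z] r t by (intro mult_left_mono) auto
      with e(2)[OF q] show ?thesis by (simp add: mult.commute)
    qed
    with e(1) show "\<exists>e>0. \<forall>s. r < s \<and> s < r + e \<longrightarrow> - \<eta> * (s - r) \<le> Y s - Y r" by blast
  qed
  have N_ge: "y \<le> mass k 0 Z r" if "t \<le> r" for r
  proof -
    have "C * (z r - Z) \<le> 0" using Z[of r] that t C0 by (simp add: mult_le_0_iff)
    then show ?thesis using mono[OF that] by (simp add: Y_def y_def)
  qed
  have growth: "y + y * (s - t) \<le> Y s" if "t \<le> s" for s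
  proof -
    have "Y t - y * t \<le> Y s - y * s"
    proof (rule right_Dini_nonneg_imp_le[OF that, of "\<lambda>s. Y s - y * s"])
      show "continuous_on {t..s} (\<lambda>s. Y s - y * s)" by (intro continuous_intros Y_cont)
      fix r \<eta> :: real assume r: "t \<le> r" "r < s" and "\<eta> > 0"
      then obtain e where e: "e > 0" "\<And>q. r < q \<Longrightarrow> q < r + e \<Longrightarrow> (q - r) * (mass k 0 Z r - \<eta>) \<le> Y q - Y r"
        using dini[of r \<eta>] t by auto
      have "- \<eta> * (q - r) \<le> Y q - y * q - (Y r - y * r)" if q: "r < q" "q < r + e" for q
      proof -
        have "(q - r) * (y - \<eta>) \<le> (q - r) * (mass k 0 Z r - \<eta>)"
          using q N_ge[of r] r by (intro mult_left_mono) auto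
        with e(2)[OF q] show ?thesis by (simp add: algebra_simps)
      qed
      with e(1) show "\<exists>e>0. \<forall>s. r < s \<and> s < r + e \<longrightarrow> - \<eta> * (s - r) \<le> Y s - y * s - (Y r - y * r)" by blast
    qed
    then show ?thesis by (simp add: y_def algebra_simps)
  qed
  have Z0: "0 \<le> Z" using Z[of 0] z_init z0_pos by simp
  define U where "U = M * exp (k * Z) * Z"
  have U: "Y s \<le> U" if "t \<le> s" for s
  proof -
    have "C * (z s - Z) \<le> 0" using Z[of s] that t C0 by (simp add: mult_le_0_iff)
    moreover have "mass k 0 Z s \<le> M * exp (k * Z) * (Z - 0)"
      using mass_le[OF M k(1), of s 0 Z Z] that t Z0 by auto
    ultimately show ?thesis by (simp add: Y_def U_def)
  qed
  have U0: "U \<ge> 0" using M Z0 by (simp add: U_def)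
  have "y + y * (t + U / y - t) \<le> U"
    using growth[of "t + U / y"] U[of "t + U / y"] U0 y by auto
  then show False using y by simp
qed

lemma free_boundary_vanishing:
  assumes nonneg: "\<And>t x. 0 \<le> t \<Longrightarrow> 0 \<le> x \<Longrightarrow> 0 \<le> w t x"
    and M: "0 < M" "\<And>t x. 0 \<le> t \<Longrightarrow> 0 \<le> x \<Longrightarrow> w t x \<le> M"
    and F: "0 \<le> K" "\<And>t x. 0 < t \<Longrightarrow> 0 < x \<Longrightarrow> x < z t \<Longrightarrow> \<bar>F t x\<bar> \<le> K * w t x"
    and Z: "(z \<longlongrightarrow> Z) at_top"
  shows "((\<lambda>t. SUP x\<in>{0..z t}. w t x) \<longlongrightarrow> 0) at_top"
proof -
  note zprops = z_mono_pos[OF nonneg]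
  have z_pos: "0 < z t" if "0 \<le> t" for t using zprops(2) that by auto
  have zZ: "z t \<le> Z" if "0 \<le> t" for t
    by (rule tendsto_lowerbound[OF Z])
       (use zprops(1) that in \<open>auto intro!: eventually_mono[OF eventually_ge_at_top[of t]]\<close>)
  have "\<bar>F t x\<bar> \<le> K * M" if "0 < t" "0 < x" "x < z t" for t x
    using F(2)[OF that] M(2)[of t x] F(1) that by (smt (verit) mult_left_mono)
  then obtain L where L: "L > 0"
      "\<And>t x y. 0 \<le> t \<Longrightarrow> 0 \<le> x \<Longrightarrow> x \<le> y \<Longrightarrow> w t x - w t y \<le> L * (y - x)"
    using w_one_sided_lipschitz[OF nonneg M] by blast
  define k where "k = sqrt ((K + 1) / D)"
  have k: "0 \<le> k" "D * k\<^sup>2 = K + 1" using F(1) D_pos by (auto simp: k_def)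
  define C where "C = D * exp (k * Z) / \<kappa>"
  have lower: "- K * w t x \<le> F t x" if "0 < t" "0 < x" "x < z t" for t x
    using F(2)[OF that] by simp
  have mass_bound: "mass k 0 Z t \<le> C * (Z - z t)" if "0 < t" for t
    using mass_le_remaining_distance[OF nonneg less_imp_le[OF M(1)] M(2) lower k zZ C_def that] .
  have sq: "w t x \<le> sqrt (4 * L * (C * (Z - z t)))" if t: "0 < t" and x: "0 \<le> x" "x \<le> z t" for t x
  proof -
    define m where "m = w t x"
    have m: "0 \<le> m" using nonneg t x by (simp add: m_def)
    define y where "y = x + m / (2 * L)"
    have xy: "x \<le> y" using m L by (simp add: y_def)
    have "m \<le> L * (z t - x)" using L(2)[of t x "z t"] t x w_outside[of t "z t"] by (simp add: m_def)
    then have "m / L \<le> z t - x" using L by (simp add: field_simps)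
    moreover have "m / (2 * L) \<le> m / L" using m L by (simp add: field_simps)
    ultimately have "y \<le> Z" using zZ[of t] t by (simp add: y_def)
    have "m\<^sup>2 / (4 * L) = integral {x..y} (\<lambda>_. m / 2)"
      using xy L by (simp add: y_def power2_eq_square)
    also have "\<dots> \<le> mass k x y t"
      unfolding mass_def
    proof (intro integral_le mass_integrable)
      fix r assume r: "r \<in> {x..y}"
      have "L * (r - x) \<le> L * (m / (2 * L))" using r L by (intro mult_left_mono) (auto simp: y_def)
      also have "\<dots> = m / 2" using L by simp
      finally have "m / 2 \<le> w t r" using L(2)[of t x r] r t x by (simp add: m_def)
      also have "\<dots> = 1 * w t r" by simp
      also have "\<dots> \<le> exp (k * r) * w t r"
        using k r x t nonneg by (intro mult_right_mono) auto
      finally show "m / 2 \<le> exp (k * r) * w t r" .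
    qed (use t x in auto)
    also have "\<dots> \<le> mass k 0 Z t"
    proof -
      have "mass k 0 Z t = mass k 0 x t + mass k x y t + mass k y Z t"
        using mass_split[of t 0 x Z k] mass_split[of t x y Z k] t x xy \<open>y \<le> Z\<close> by auto
      then show ?thesis
        using mass_nonneg[OF nonneg, where t = t and a = 0 and b = x and k = k]
          mass_nonneg[OF nonneg, where t = t and a = y and b = Z and k = k] t x xy by auto
    qed
    also have "\<dots> \<le> C * (Z - z t)" using mass_bound t by simp
    finally have "m\<^sup>2 \<le> 4 * L * (C * (Z - z t))" using L by (simp add: field_simps)
    then show ?thesis unfolding m_def[symmetric] by (rule real_le_rsqrt)
  qed
  show ?thesis
  proof (rule tendsto_sandwich[where f = "\<lambda>_. 0" and h = "\<lambda>t. sqrt (4 * L * (C * (Z - z t)))"])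
    show "\<forall>\<^sub>F t in at_top. 0 \<le> (SUP x\<in>{0..z t}. w t x)"
      using eventually_gt_at_top[of 0]
    proof eventually_elim
      case (elim t)
      have "bdd_above (w t ` {0..z t})" using M elim by (intro bdd_aboveI[of _ M]) auto
      then show ?case
        using elim nonneg[of t 0] z_pos[of t] by (intro cSUP_upper2[of _ _ 0]) auto
    qed
    show "\<forall>\<^sub>F t in at_top. (SUP x\<in>{0..z t}. w t x) \<le> sqrt (4 * L * (C * (Z - z t)))"
      using eventually_gt_at_top[of 0]
    proof eventually_elim
      case (elim t)
      then show ?case using z_pos[of t] by (intro cSUP_least sq) auto
    qed
    have "((\<lambda>t. sqrt (4 * L * (C * (Z - z t)))) \<longlongrightarrow> sqrt (4 * L * (C * (Z - Z)))) at_top"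
      by (intro tendsto_intros Z)
    then show "((\<lambda>t. sqrt (4 * L * (C * (Z - z t)))) \<longlongrightarrow> 0) at_top" by simp
  qed auto
qed

end

theorem theorem4p1:
  fixes a b c d \<beta> \<mu> g0 h0 :: real
    and u0 v0 g h :: "real \<Rightarrow> real" and u v :: "real \<Rightarrow> real \<Rightarrow> real"
  assumes "a > 0" "b > 0" "c > 0" "d > 0" "\<beta> > 0" "\<mu> > 0"
    and "0 < h0" "h0 \<le> g0"
    and "initial_datum u0 g0" "initial_datum v0 h0"
    and "fbp_solution a b c d \<beta> \<mu> g0 h0 u0 v0 u v g h"
  shows "((\<exists>G. (g \<longlongrightarrow> G) at_top) \<longrightarrow> ((\<lambda>t. SUP x\<in>{0..g t}. u t x) \<longlongrightarrow> 0) at_top)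
       \<and> ((\<exists>H. (h \<longlongrightarrow> H) at_top) \<longrightarrow> ((\<lambda>t. SUP x\<in>{0..h t}. v t x) \<longlongrightarrow> 0) at_top)"
proof -
  define f where "f = (\<lambda>t x. u t x * (a - u t x - b * v t x))"
  define k where "k = (\<lambda>t x. v t x * (1 - v t x + c * u t x))"
  have "fb_component d \<beta> f u g u0 g0" "fb_component 1 \<mu> k v h v0 h0"
    using assms(11) by (auto simp: fbp_solution_def f_def k_def)
  with assms obtain ux uxx ut vx vxx vt where
    "free_boundary d \<beta> g0 f u ux uxx ut g u0" "free_boundary 1 \<mu> h0 k v vx vxx vt h v0"
    using fb_component_imp_free_boundary[of d \<beta> f u g u0 g0] fb_component_imp_free_boundary[of 1 \<mu> k v h v0 h0]
    by auto
  then interpret U: free_boundary d \<beta> g0 f u ux uxx ut g u0 + V: free_boundary 1 \<mu> h0 k v vx vxx vt h v0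
    by auto
  have u_nonneg: "0 \<le> u t x" if "0 \<le> t" "0 \<le> x" for t x
  proof (rule U.w_nonneg[OF _ that])
    fix T
    obtain Bu Bv where B: "\<And>t x. 0 \<le> t \<Longrightarrow> t \<le> T \<Longrightarrow> 0 \<le> x \<Longrightarrow> \<bar>u t x\<bar> \<le> Bu"
        "\<And>t x. 0 \<le> t \<Longrightarrow> t \<le> T \<Longrightarrow> 0 \<le> x \<Longrightarrow> \<bar>v t x\<bar> \<le> Bv"
      using U.w_bounded_on[of T] V.w_bounded_on[of T] by blast
    have "(a + Bu + b * Bv) * u t x \<le> f t x" if "0 < t" "t \<le> T" "0 < x" "u t x < 0" for t x
    proof -
      have "- (b * v t x) \<le> b * Bv" using B(2)[of t x] that mult_left_mono[of "- v t x" Bv b] \<open>b > 0\<close> by auto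
      then have "a - u t x - b * v t x \<le> a + Bu + b * Bv" using B(1)[of t x] that by auto
      then show ?thesis unfolding f_def using that by (simp add: mult.commute mult_left_mono_neg)
    qed
    then show "\<exists>Q. \<forall>t x. 0 < t \<longrightarrow> t \<le> T \<longrightarrow> 0 < x \<longrightarrow> x < g t \<longrightarrow> u t x < 0 \<longrightarrow> Q * u t x \<le> f t x" by blast
  qed
  have v_nonneg: "0 \<le> v t x" if "0 \<le> t" "0 \<le> x" for t x
  proof (rule V.w_nonneg[OF _ that])
    fix T
    obtain Bu Bv where B: "\<And>t x. 0 \<le> t \<Longrightarrow> t \<le> T \<Longrightarrow> 0 \<le> x \<Longrightarrow> \<bar>u t x\<bar> \<le> Bu"
        "\<And>t x. 0 \<le> t \<Longrightarrow> t \<le> T \<Longrightarrow> 0 \<le> x \<Longrightarrow> \<bar>v t x\<bar> \<le> Bv"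
      using U.w_bounded_on[of T] V.w_bounded_on[of T] by blast
    have "(1 + Bv + c * Bu) * v t x \<le> k t x" if "0 < t" "t \<le> T" "0 < x" "v t x < 0" for t x
    proof -
      have "c * u t x \<le> c * Bu" using B(1)[of t x] that mult_left_mono[of "u t x" Bu c] \<open>c > 0\<close> by auto
      then have "1 - v t x + c * u t x \<le> 1 + Bv + c * Bu" using B(2)[of t x] that by auto
      then show ?thesis unfolding k_def using that by (simp add: mult.commute mult_left_mono_neg)
    qed
    then show "\<exists>Q. \<forall>t x. 0 < t \<longrightarrow> t \<le> T \<longrightarrow> 0 < x \<longrightarrow> x < h t \<longrightarrow> v t x < 0 \<longrightarrow> Q * v t x \<le> k t x" by blast
  qed
  obtain B1 B2 where B: "B1 \<ge> 0" "\<And>x. 0 \<le> x \<Longrightarrow> \<bar>u 0 x\<bar> \<le> B1" "B2 \<ge> 0" "\<And>x. 0 \<le> x \<Longrightarrow> \<bar>v 0 x\<bar> \<le> B2"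
    using U.w_bounded_on[of 0] V.w_bounded_on[of 0] by auto
  define Mu where "Mu = a + B1"
  define Mv where "Mv = 1 + c * Mu + B2"
  have Mu: "Mu > 0" and Mv: "Mv > 0" using assms(1-3) B by (auto simp: Mu_def Mv_def add_pos_nonneg)
  have u_le: "u t x \<le> Mu" if "0 \<le> t" "0 \<le> x" for t x
  proof (rule U.w_bounded_above[OF less_imp_le[OF Mu] _ _ that])
    fix x :: real assume "0 \<le> x"
    then show "u0 x \<le> Mu" using B(2)[of x] U.w_init[of x] assms(1) by (simp add: Mu_def)
  next
    fix t x assume tx: "0 < t" "0 < x" "Mu < u t x"
    have "0 \<le> b * v t x" using v_nonneg[of t x] tx assms(2) by simp
    then show "f t x < 0" unfolding f_def using tx Mu B(1) by (intro mult_pos_neg) (auto simp: Mu_def)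
  qed
  have v_le: "v t x \<le> Mv" if "0 \<le> t" "0 \<le> x" for t x
  proof (rule V.w_bounded_above[OF less_imp_le[OF Mv] _ _ that])
    fix x :: real assume "0 \<le> x"
    then show "v0 x \<le> Mv"
      using B(4)[of x] V.w_init[of x] mult_pos_pos[OF assms(3) Mu] by (simp add: Mv_def)
  next
    fix t x assume tx: "0 < t" "0 < x" "Mv < v t x"
    have "c * u t x \<le> c * Mu" using u_le[of t x] tx assms(3) by simp
    then show "k t x < 0" unfolding k_def using tx Mv B(3) by (intro mult_pos_neg) (auto simp: Mv_def)
  qed
  have f_bound: "\<bar>f t x\<bar> \<le> (a + Mu + b * Mv) * u t x" if "0 < t" "0 < x" for t x
  proof -
    have "0 \<le> b * v t x" "b * v t x \<le> b * Mv" using v_nonneg[of t x] v_le[of t x] that assms(2) by auto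
    then have "\<bar>a - u t x - b * v t x\<bar> \<le> a + Mu + b * Mv"
      using u_nonneg[of t x] u_le[of t x] that assms(1) by (auto simp: abs_le_iff)
    then show ?thesis
      using u_nonneg[of t x] that by (simp add: f_def abs_mult mult.commute mult_left_mono)
  qed
  have k_bound: "\<bar>k t x\<bar> \<le> (1 + Mv + c * Mu) * v t x" if "0 < t" "0 < x" for t x
  proof -
    have "0 \<le> c * u t x" "c * u t x \<le> c * Mu" using u_nonneg[of t x] u_le[of t x] that assms(3) by auto
    then have "\<bar>1 - v t x + c * u t x\<bar> \<le> 1 + Mv + c * Mu"
      using v_nonneg[of t x] v_le[of t x] that by (auto simp: abs_le_iff)
    then show ?thesis
      using v_nonneg[of t x] that by (simp add: k_def abs_mult mult.commute mult_left_mono)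
  qed
  show ?thesis
  proof (intro conjI impI; elim exE)
    fix G assume "(g \<longlongrightarrow> G) at_top"
    then show "((\<lambda>t. SUP x\<in>{0..g t}. u t x) \<longlongrightarrow> 0) at_top"
      using U.free_boundary_vanishing[OF u_nonneg Mu u_le _ f_bound, of G] assms(1,2) Mu Mv by simp
  next
    fix H assume "(h \<longlongrightarrow> H) at_top"
    then show "((\<lambda>t. SUP x\<in>{0..h t}. v t x) \<longlongrightarrow> 0) at_top"
      using V.free_boundary_vanishing[OF v_nonneg Mv v_le _ k_bound, of H] assms(3) Mu Mv by simp
  qed
qed

end
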